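(* Let $L\subseteq\mathbb{R}^3$ be a centrally symmetric compact convex set. Then $L$ is $2$-reliable if and only if $L$ is a cylinder.
   Context: All compact convex sets are nonempty. A compact convex set $L$ is centrally symmetric if $L$ and $-L$ are translates of each other. For a linear subspace $\xi$ of $\mathbb{R}^3$, $K_\xi$ denotes the orthogonal projection of $K$ onto $\xi$. A compact convex set $L\subseteq\mathbb{R}^3$ is $2$-reliable if, for every compact convex $K\subseteq\mathbb{R}^3$ such that $L_\xi$ contains a translate of $K_\xi$ for every $2$-dimensional linear subspace $\xi\subseteq\mathbb{R}^3$, the set $L$ contains a translate of $K$. A cylinder in $\mathbb{R}^3$ is a $2$-decomposable set: there exist a direct sum decomposition into linear subspaces $\mathbb{R}^3=\xi_1\oplus\cdots\oplus\xi_m$ with $\dim\xi_i\le2$ for each $i$, and compact convex sets $L_i\subseteq\xi_i$, such that $L=L_1+\cdots+L_m$ (Minkowski sum). (Thus a cylinder is the Minkowski sum of a planar compact convex set and a possibly degenerate segment transversal to its plane.) *)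

theory Defs
  imports "HOL-Analysis.Analysis"
begin

definition compact_convex :: "'a::euclidean_space set \<Rightarrow> bool" where
  "compact_convex K \<longleftrightarrow> K \<noteq> {} \<and> compact K \<and> convex K"

definition centrally_symmetric :: "'a::euclidean_space set \<Rightarrow> bool" where
  "centrally_symmetric L \<longleftrightarrow> (\<exists>v. uminus ` L = (+) v ` L)"

definition contains_translate :: "'a::euclidean_space set \<Rightarrow> 'a set \<Rightarrow> bool" where
  "contains_translate L K \<longleftrightarrow> (\<exists>v. (+) v ` K \<subseteq> L)"

text \<open>Meaningful only for a linear subspace \<open>\<xi>\<close>.\<close>
definition orth_proj :: "'a::euclidean_space set \<Rightarrow> 'a \<Rightarrow> 'a" where
  "orth_proj \<xi> x = (THE y. y \<in> \<xi> \<and> (\<forall>z\<in>\<xi>. orthogonal (x - y) z))"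

lemma orth_proj_ex1:
  fixes \<xi> :: "'a::euclidean_space set"
  assumes "subspace \<xi>"
  shows "\<exists>!y. y \<in> \<xi> \<and> (\<forall>z\<in>\<xi>. orthogonal (x - y) z)"
proof -
  obtain y w where y: "y \<in> span \<xi>" and w: "\<And>z. z \<in> span \<xi> \<Longrightarrow> orthogonal w z" and x: "x = y + w"
    using orthogonal_subspace_decomp_exists[of \<xi> x] by metis
  have s: "span \<xi> = \<xi>"
    using assms by (simp add: span_eq_iff)
  show ?thesis
  proof (rule ex1I[of _ y])
    show "y \<in> \<xi> \<and> (\<forall>z\<in>\<xi>. orthogonal (x - y) z)"
      using y w x s by simp
  next
    fix y'
    assume y': "y' \<in> \<xi> \<and> (\<forall>z\<in>\<xi>. orthogonal (x - y') z)"
    have "y' - y \<in> \<xi>"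
      using y y' s assms by (simp add: subspace_diff)
    then have "(x - y') \<bullet> (y' - y) = 0" "(x - y) \<bullet> (y' - y) = 0"
      using y' w x s by (auto simp: orthogonal_def)
    then have "(y' - y) \<bullet> (y' - y) = 0"
      by (simp add: inner_diff_left)
    then show "y' = y"
      by simp
  qed
qed

definition reliable :: "nat \<Rightarrow> 'a::euclidean_space set \<Rightarrow> bool" where
  "reliable d L \<longleftrightarrow> compact_convex L \<and>
     (\<forall>K. compact_convex K \<longrightarrow>
        (\<forall>\<xi>. subspace \<xi> \<and> dim \<xi> = d \<longrightarrow> contains_translate (orth_proj \<xi> ` L) (orth_proj \<xi> ` K)) \<longrightarrow>
        contains_translate L K)"

definition direct_sum_decomposition :: "nat \<Rightarrow> (nat \<Rightarrow> 'a::euclidean_space set) \<Rightarrow> bool" where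
  "direct_sum_decomposition m \<xi> \<longleftrightarrow>
     (\<forall>i<m. subspace (\<xi> i)) \<and> (\<forall>x. \<exists>!f. f \<in> Pi\<^sub>E {..<m} \<xi> \<and> x = (\<Sum>i<m. f i))"

text \<open>The sum of the sets \<open>Li i\<close> is the Minkowski sum, from \<open>HOL-Library.Set_Algebras\<close>.\<close>
definition decomposable :: "nat \<Rightarrow> 'a::euclidean_space set \<Rightarrow> bool" where
  "decomposable d L \<longleftrightarrow>
     (\<exists>m \<xi> Li. direct_sum_decomposition m \<xi> \<and>
        (\<forall>i<m. dim (\<xi> i) \<le> d \<and> compact_convex (Li i) \<and> Li i \<subseteq> \<xi> i) \<and>
        L = (\<Sum>i<m. Li i))"

definition cylinder :: "(real ^ 3) set \<Rightarrow> bool" where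
  "cylinder L \<longleftrightarrow> decomposable 2 L"

end

theory Submission
  imports Defs
begin

text \<open>Containment in a cylinder can be tested on each summand separately, and the linear projection
  onto a summand of dimension at most two factors through an orthogonal projection onto a plane;
  hence cylinders are reliable.

  Conversely, consider the unit normals \<open>u\<close> of \<open>L\<close> at boundary points touched from inside by a
  ball; \<open>L\<close> is the intersection of the supporting half-spaces with these normals. Four such
  normals, any three of them independent and with a vanishing positive combination, would make a
  slight enlargement of the tetrahedron spanned by their boundary points violate reliability. By
  symmetry signs do not matter, so among the normals there are no four in general position. Hence
  all of them except one antipodal pair lie in a plane, which exhibits \<open>L\<close> as a cylinder.\<close>

section \<open>Orthogonal projections and the linear maps that factor through them\<close>

lemma orth_proj_mem:
  assumes "subspace \<xi>" shows "orth_proj \<xi> x \<in> \<xi>"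
  using theI'[OF orth_proj_ex1[OF assms]] by (simp add: orth_proj_def)

lemma orth_proj_orthogonal:
  assumes "subspace \<xi>" "z \<in> \<xi>" shows "orthogonal (x - orth_proj \<xi> x) z"
  using theI'[OF orth_proj_ex1[OF assms(1)]] assms(2) by (simp add: orth_proj_def)

lemma orth_proj_unique:
  assumes "subspace \<xi>" "y \<in> \<xi>" "\<And>z. z \<in> \<xi> \<Longrightarrow> orthogonal (x - y) z"
  shows "orth_proj \<xi> x = y"
  unfolding orth_proj_def by (rule the1_equality[OF orth_proj_ex1[OF assms(1)]]) (use assms in auto)

lemma linear_orth_proj:
  assumes "subspace \<xi>" shows "linear (orth_proj \<xi>)"
proof (rule linearI)
  fix x y :: 'a and c :: real
  show "orth_proj \<xi> (x + y) = orth_proj \<xi> x + orth_proj \<xi> y"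
  proof (rule orth_proj_unique[OF assms])
    fix z assume "z \<in> \<xi>"
    then have "orthogonal ((x - orth_proj \<xi> x) + (y - orth_proj \<xi> y)) z"
      by (intro orthogonal_clauses orth_proj_orthogonal assms)
    then show "orthogonal (x + y - (orth_proj \<xi> x + orth_proj \<xi> y)) z"
      by (simp add: algebra_simps)
  qed (simp add: orth_proj_mem assms subspace_add)
  show "orth_proj \<xi> (c *\<^sub>R x) = c *\<^sub>R orth_proj \<xi> x"
  proof (rule orth_proj_unique[OF assms])
    fix z assume "z \<in> \<xi>"
    then have "orthogonal (c *\<^sub>R (x - orth_proj \<xi> x)) z"
      by (intro orthogonal_clauses orth_proj_orthogonal assms)
    then show "orthogonal (c *\<^sub>R x - c *\<^sub>R orth_proj \<xi> x) z"
      by (simp add: algebra_simps)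
  qed (simp add: orth_proj_mem assms subspace_scale)
qed

text \<open>A linear map of rank at most \<open>d\<close> factors through the orthogonal projection onto any
  \<open>d\<close>-dimensional subspace containing the orthogonal complement of its kernel.\<close>
lemma linear_factors_orth_proj:
  fixes g :: "'a::euclidean_space \<Rightarrow> 'b::euclidean_space"
  assumes g: "linear g" and rank: "dim (range g) \<le> d" and d: "d \<le> DIM('a)"
  obtains \<xi> where "subspace \<xi>" "dim \<xi> = d" "\<And>x. g (orth_proj \<xi> x) = g x"
proof -
  define N where "N = {x. g x = 0}"
  have N: "subspace N"
    unfolding N_def by (rule linear_subspace_kernel[OF g])
  \<comment> \<open>\<open>g\<close> is injective on the orthogonal complement \<open>C\<close> of
    its kernel, so the rank bound makes the kernel at least
    \<open>DIM('a) - d\<close>-dimensional.\<close>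
  define C where "C = {y \<in> UNIV. \<forall>x\<in>N. orthogonal x y}"
  have C: "subspace C"
    unfolding C_def subspace_def by (auto simp: orthogonal_clauses)
  have dC: "dim C + dim N = DIM('a)"
    unfolding C_def using dim_subspace_orthogonal_to_vectors[OF N subspace_UNIV] by simp
  have "inj_on g C"
  proof (rule inj_onI)
    fix x y assume xy: "x \<in> C" "y \<in> C" "g x = g y"
    then have "x - y \<in> N" "x - y \<in> C"
      by (simp_all add: N_def linear_diff[OF g] subspace_diff C)
    then have "orthogonal (x - y) (x - y)" by (auto simp: C_def)
    then show "x = y" by (simp add: orthogonal_def)
  qed
  then have "dim (g ` C) = dim C"
    using C g by (intro dim_image_eq) (auto simp: span_eq_iff[THEN iffD2])
  moreover have "dim (g ` C) \<le> dim (range g)" by (intro dim_subset) auto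
  ultimately have "DIM('a) - d \<le> dim N" using dC rank by linarith
  \<comment> \<open>The kernel may be larger than that; a subspace \<open>M\<close> of it of
    dimension exactly \<open>DIM('a) - d\<close> has a complement of dimension exactly
    \<open>d\<close>.\<close>
  then obtain M where M: "subspace M" "M \<subseteq> span N" "dim M = DIM('a) - d"
    by (rule choose_subspace_of_subspace)
  define \<xi> where "\<xi> = {y \<in> UNIV. \<forall>x\<in>M. orthogonal x y}"
  have \<xi>: "subspace \<xi>"
    unfolding \<xi>_def subspace_def by (auto simp: orthogonal_clauses)
  have "dim \<xi> + dim M = DIM('a)"
    unfolding \<xi>_def using dim_subspace_orthogonal_to_vectors[OF M(1) subspace_UNIV] by simp
  then have dim: "dim \<xi> = d" using M(3) d by linarith
  have "g (orth_proj \<xi> x) = g x" for x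
  proof -
    obtain y w where y: "y \<in> span M" and w: "\<And>z. z \<in> span M \<Longrightarrow> orthogonal w z" and x: "x = y + w"
      using orthogonal_subspace_decomp_exists[of M x] by metis
    have sM: "span M = M" using M(1) by (simp add: span_eq_iff)
    have "orth_proj \<xi> x = w"
    proof (rule orth_proj_unique[OF \<xi>])
      show "w \<in> \<xi>" using w sM by (auto simp: \<xi>_def orthogonal_commute)
      show "orthogonal (x - w) z" if "z \<in> \<xi>" for z
        using that y sM x by (auto simp: \<xi>_def)
    qed
    moreover have "y \<in> N" using y sM M(2) N by (auto simp: span_eq_iff[THEN iffD2])
    ultimately show ?thesis by (simp add: x linear_add[OF g] N_def)
  qed
  with \<xi> dim that show thesis by blast
qed

section \<open>Reliability of decomposable sets\<close>

text \<open>Linearity comes from uniqueness: adding or scaling decompositions componentwise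
  decomposes the sum or the multiple.\<close>

lemma direct_sum_component_maps:
  assumes "direct_sum_decomposition m \<xi>"
  obtains g where "\<And>i. i < m \<Longrightarrow> linear (g i)" "\<And>i x. i < m \<Longrightarrow> g i x \<in> \<xi> i"
    "\<And>x. (\<Sum>i<m. g i x) = x"
    "\<And>f i. (\<And>j. j < m \<Longrightarrow> f j \<in> \<xi> j) \<Longrightarrow> i < m \<Longrightarrow> g i (\<Sum>j<m. f j) = f i"
proof -
  have sub: "\<And>i. i < m \<Longrightarrow> subspace (\<xi> i)"
    and ex1: "\<And>x. \<exists>!f. f \<in> Pi\<^sub>E {..<m} \<xi> \<and> x = (\<Sum>i<m. f i)"
    using assms by (auto simp: direct_sum_decomposition_def)
  define h where "h x = (THE f. f \<in> Pi\<^sub>E {..<m} \<xi> \<and> x = (\<Sum>i<m. f i))" for x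
  have h: "h x \<in> Pi\<^sub>E {..<m} \<xi> \<and> x = (\<Sum>i<m. h x i)" for x
    unfolding h_def by (rule theI'[OF ex1])
  have mem: "h x i \<in> \<xi> i" if "i < m" for i x using h that by auto
  have sum: "(\<Sum>i<m. h x i) = x" for x using h by simp
  have uniq: "h (\<Sum>j<m. f j) i = f i" if f: "\<And>j. j < m \<Longrightarrow> f j \<in> \<xi> j" and i: "i < m" for f i
  proof -
    \<comment> \<open>Uniqueness holds among functions that are \<open>undefined\<close> off
      \<open>{..<m}\<close>, hence the \<open>restrict\<close>.\<close>
    have "h (\<Sum>j<m. f j) = restrict f {..<m}"
      unfolding h_def by (rule the1_equality[OF ex1]) (use f in auto)
    then show ?thesis using i by simp
  qed
  have "linear (\<lambda>x. h x i)" if i: "i < m" for i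
  proof (rule linearI)
    fix x y :: 'a and c :: real
    have "h (\<Sum>j<m. h x j + h y j) i = h x i + h y i"
      by (rule uniq) (auto intro!: subspace_add sub mem i)
    then show "h (x + y) i = h x i + h y i" by (simp add: sum.distrib sum)
    have "h (\<Sum>j<m. c *\<^sub>R h x j) i = c *\<^sub>R h x i"
      by (rule uniq) (auto intro!: subspace_scale sub mem i)
    then show "h (c *\<^sub>R x) i = c *\<^sub>R h x i" by (simp add: scaleR_right.sum[symmetric] sum)
  qed
  with mem sum uniq that[of "\<lambda>i x. h x i"] show thesis by blast
qed

text \<open>The component map onto a summand has rank at most \<open>d\<close>, so one
  \<open>d\<close>-dimensional shadow provides a translation \<open>v i\<close> that brings the
  component of \<open>K\<close> into \<open>Li i\<close>. These translations lie in different
  summands and do not interfere, so their sum translates \<open>K\<close> into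
  \<open>L\<close>.\<close>

theorem decomposable_imp_reliable:
  fixes L :: "'a::euclidean_space set"
  assumes L: "compact_convex L" and dec: "decomposable d L" and d: "d \<le> DIM('a)"
  shows "reliable d L"
  unfolding reliable_def
proof (intro conjI allI impI L)
  fix K :: "'a set"
  assume K: "\<forall>\<xi>. subspace \<xi> \<and> dim \<xi> = d \<longrightarrow> contains_translate (orth_proj \<xi> ` L) (orth_proj \<xi> ` K)"
  obtain m \<xi> Li where dsd: "direct_sum_decomposition m \<xi>"
    and Li: "\<And>i. i < m \<Longrightarrow> dim (\<xi> i) \<le> d" "\<And>i. i < m \<Longrightarrow> Li i \<subseteq> \<xi> i"
    and Lsum: "L = (\<Sum>i<m. Li i)"
    using dec unfolding decomposable_def by blast
  obtain g where lin: "\<And>i. i < m \<Longrightarrow> linear (g i)" and mem: "\<And>i x. i < m \<Longrightarrow> g i x \<in> \<xi> i"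
    and sum: "\<And>x. (\<Sum>i<m. g i x) = x"
    and uniq: "\<And>f i. (\<And>j. j < m \<Longrightarrow> f j \<in> \<xi> j) \<Longrightarrow> i < m \<Longrightarrow> g i (\<Sum>j<m. f j) = f i"
    using direct_sum_component_maps[OF dsd] by blast
  have Lset: "L = {sum s {..<m} |s. \<forall>i\<in>{..<m}. s i \<in> Li i}"
    unfolding Lsum by (rule set_sum_alt) simp
  have gL: "g i x \<in> Li i" if i: "i < m" and x: "x \<in> L" for i x
  proof -
    obtain s where s: "x = sum s {..<m}" "\<forall>i\<in>{..<m}. s i \<in> Li i" using x Lset by blast
    have "g i x = s i" unfolding s(1) by (rule uniq) (use s Li i in auto)
    then show ?thesis using s i by auto
  qed
  have "\<exists>v. v \<in> \<xi> i \<and> (\<forall>x\<in>K. v + g i x \<in> Li i)" if i: "i < m" for i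
  proof -
    have "dim (range (g i)) \<le> dim (\<xi> i)" using mem[OF i] by (intro dim_subset) auto
    then have rank: "dim (range (g i)) \<le> d" using Li(1)[OF i] by simp
    obtain \<eta> where \<eta>: "subspace \<eta>" "dim \<eta> = d" and fac: "\<And>x. g i (orth_proj \<eta> x) = g i x"
      using linear_factors_orth_proj[OF lin[OF i] rank d] by blast
    obtain v where v: "(+) v ` orth_proj \<eta> ` K \<subseteq> orth_proj \<eta> ` L"
      using K \<eta> unfolding contains_translate_def by blast
    have "g i v + g i x \<in> Li i" if x: "x \<in> K" for x
    proof -
      obtain y where y: "y \<in> L" "v + orth_proj \<eta> x = orth_proj \<eta> y" using v x by auto
      then have "g i (v + orth_proj \<eta> x) = g i y" by (simp add: fac)
      then show ?thesis using gL[OF i y(1)] by (simp add: linear_add[OF lin[OF i]] fac)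
    qed
    then show ?thesis using mem[OF i] by blast
  qed
  then obtain v where v: "\<And>i x. i < m \<Longrightarrow> x \<in> K \<Longrightarrow> v i + g i x \<in> Li i" by metis
  have "(\<Sum>i<m. v i) + x \<in> L" if x: "x \<in> K" for x
  proof -
    have "(\<Sum>i<m. v i) + x = (\<Sum>i<m. v i + g i x)" by (simp add: sum.distrib sum)
    then show ?thesis unfolding Lset using v[OF _ x] by blast
  qed
  then show "contains_translate L K" unfolding contains_translate_def by auto
qed

section \<open>A criterion for cylinders\<close>

text \<open>The point in \<open>mix\<close> is \<open>x\<close> slid parallel to \<open>e\<close> to
  the level of \<open>y\<close> under \<open>f\<close>. Closure under this move makes
  \<open>L\<close> the sum of its projection along \<open>e\<close> to the plane orthogonal to
  \<open>f\<close> and its projection along that plane to the line of \<open>e\<close>.\<close>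

lemma cylinderI:
  fixes L :: "(real ^ 3) set"
  assumes L: "compact_convex L" and fe: "f \<bullet> e \<noteq> 0"
    and mix: "\<And>x y. x \<in> L \<Longrightarrow> y \<in> L \<Longrightarrow> x + ((f \<bullet> y - f \<bullet> x) / (f \<bullet> e)) *\<^sub>R e \<in> L"
  shows "cylinder L"
proof -
  define p where "p x = x - ((f \<bullet> x) / (f \<bullet> e)) *\<^sub>R e" for x
  define q where "q x = ((f \<bullet> x) / (f \<bullet> e)) *\<^sub>R e" for x
  have lp: "linear p" unfolding p_def by (rule linearI) (simp_all add: inner_simps algebra_simps add_divide_distrib)
  have lq: "linear q" unfolding q_def by (rule linearI) (simp_all add: inner_simps algebra_simps add_divide_distrib)
  have pq: "p x + q x = x" for x by (simp add: p_def q_def)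
  define \<xi> where "\<xi> i = (if i = (0::nat) then {x. f \<bullet> x = 0} else span {e})" for i
  define Li where "Li i = (if i = (0::nat) then p ` L else q ` L)" for i
  have p\<xi>: "p x \<in> \<xi> 0" for x using fe by (simp add: p_def \<xi>_def inner_simps)
  have q\<xi>: "q x \<in> \<xi> 1" for x by (simp add: q_def \<xi>_def span_base span_mul)
  have comp: "p x = a \<and> q x = b" if ab: "x = a + b" "a \<in> \<xi> 0" "b \<in> \<xi> 1" for x a b
  proof -
    obtain k where k: "b = k *\<^sub>R e" using ab(3) by (auto simp: \<xi>_def span_singleton)
    have "f \<bullet> a = 0" using ab(2) by (simp add: \<xi>_def)
    then show ?thesis using ab(1) k fe by (simp add: p_def q_def inner_simps)
  qed
  have dsd: "direct_sum_decomposition 2 \<xi>"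
    unfolding direct_sum_decomposition_def
  proof (intro conjI allI impI)
    show "subspace (\<xi> i)" for i by (simp add: \<xi>_def subspace_hyperplane)
    fix x
    show "\<exists>!g. g \<in> Pi\<^sub>E {..<2} \<xi> \<and> x = (\<Sum>i<2. g i)"
    proof (rule ex1I)
      let ?g = "restrict (\<lambda>i. if i = 0 then p x else q x) {..<2::nat}"
      show "?g \<in> Pi\<^sub>E {..<2} \<xi> \<and> x = (\<Sum>i<2. ?g i)"
        using p\<xi>[of x] q\<xi>[of x] pq[of x] by (auto simp: numeral_2_eq_2 less_Suc_eq)
      fix g assume g: "g \<in> Pi\<^sub>E {..<2} \<xi> \<and> x = (\<Sum>i<2. g i)"
      then have "p x = g 0 \<and> q x = g 1"
        by (intro comp) (auto simp: numeral_2_eq_2 PiE_def Pi_def)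
      then show "g = ?g"
        using g by (intro ext) (auto simp: numeral_2_eq_2 less_Suc_eq PiE_def extensional_def)
    qed
  qed
  have "f \<noteq> 0" using fe by auto
  then have "dim (\<xi> 0) = 2" unfolding \<xi>_def by (simp add: dim_hyperplane)
  moreover have "dim (\<xi> 1) \<le> 2"
  proof -
    have "dim {e} \<le> card {e}" by (rule dim_le_card') simp
    then show ?thesis by (simp add: \<xi>_def)
  qed
  moreover have "compact_convex (p ` L)" "compact_convex (q ` L)"
    using L lp lq by (auto simp: compact_convex_def linear_conv_bounded_linear
        intro!: compact_continuous_image linear_continuous_on convex_linear_image)
  moreover have "p ` L \<subseteq> \<xi> 0" "q ` L \<subseteq> \<xi> 1" using p\<xi> q\<xi> by auto
  ultimately have "\<forall>i<2. dim (\<xi> i) \<le> 2 \<and> compact_convex (Li i) \<and> Li i \<subseteq> \<xi> i"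
    by (auto simp: Li_def numeral_2_eq_2 less_Suc_eq)
  moreover have "L = (\<Sum>i<2. Li i)"
  proof -
    have "(\<Sum>i<2. Li i) = p ` L + q ` L"
      by (simp add: numeral_2_eq_2 Li_def)
    moreover have "p x + q y \<in> L" if "x \<in> L" "y \<in> L" for x y
      using mix[OF that] by (simp add: p_def q_def diff_divide_distrib algebra_simps)
    moreover have "x \<in> p ` L + q ` L" if "x \<in> L" for x
      using that pq[of x] by (metis image_eqI set_plus_intro)
    ultimately show ?thesis by (auto simp: set_plus_def)
  qed
  ultimately show ?thesis unfolding cylinder_def decomposable_def using dsd by blast
qed

section \<open>Normals at boundary points touched by inner balls\<close>

text \<open>The touching point is \<open>c + r *\<^sub>R u\<close>. The inner ball is what later
  guarantees that a small step from this point, at an obtuse angle to \<open>u\<close>, ends in the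
  interior of \<open>L\<close>.\<close>

definition touching_normals :: "'a::euclidean_space set \<Rightarrow> 'a set" where
  "touching_normals L =
     {u. norm u = 1 \<and> (\<exists>c r. 0 < r \<and> cball c r \<subseteq> L \<and> (\<forall>z\<in>L. u \<bullet> z \<le> u \<bullet> c + r))}"

lemma unit_separation:
  fixes L :: "'a::euclidean_space set"
  assumes L: "compact_convex L" and y: "y \<notin> L"
  obtains u b where "norm u = 1" "\<And>z. z \<in> L \<Longrightarrow> u \<bullet> z \<le> b" "b < u \<bullet> y"
proof -
  have "convex L" "closed L" "L \<noteq> {}" using L by (auto simp: compact_convex_def compact_imp_closed)
  then obtain a b where ab: "a \<bullet> y < b" "\<forall>x\<in>L. a \<bullet> x > b"
    using separating_hyperplane_closed_point y by metis
  obtain x where "x \<in> L" using \<open>L \<noteq> {}\<close> by blast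
  then have a: "a \<noteq> 0" using ab by force
  show thesis
  proof (rule that)
    show "norm (- (inverse (norm a) *\<^sub>R a)) = 1" using a by simp
    show "- (inverse (norm a) *\<^sub>R a) \<bullet> z \<le> - (inverse (norm a) * b)" if "z \<in> L" for z
      using ab(2) that a by (auto simp: intro!: mult_left_mono less_imp_le)
    show "- (inverse (norm a) * b) < - (inverse (norm a) *\<^sub>R a) \<bullet> y"
      using ab(1) a by simp
  qed
qed

text \<open>Gives continuity of the support function, so that a maximum over the unit sphere is
  attained below.\<close>

lemma support_function_lipschitz:
  fixes D :: "'a::euclidean_space set"
  assumes D: "D \<noteq> {}" and M: "\<And>x. x \<in> D \<Longrightarrow> norm x \<le> M"
  shows "\<bar>(SUP x\<in>D. u \<bullet> x) - (SUP x\<in>D. v \<bullet> x)\<bar> \<le> M * norm (u - v)"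
proof -
  have bdd: "bdd_above ((\<lambda>x. w \<bullet> x) ` D)" for w
  proof (rule bdd_aboveI2)
    fix x assume "x \<in> D"
    then show "w \<bullet> x \<le> norm w * M"
      using norm_cauchy_schwarz[of w x] mult_left_mono[OF M norm_ge_zero, of x w] by linarith
  qed
  have "(SUP x\<in>D. w \<bullet> x) \<le> (SUP x\<in>D. w' \<bullet> x) + M * norm (w - w')" for w w'
  proof (rule cSUP_least[OF D])
    fix x assume x: "x \<in> D"
    have "w \<bullet> x = w' \<bullet> x + (w - w') \<bullet> x" by (simp add: inner_simps)
    also have "\<dots> \<le> (SUP x\<in>D. w' \<bullet> x) + norm (w - w') * norm x"
      by (intro add_mono cSUP_upper x bdd norm_cauchy_schwarz)
    also have "norm (w - w') * norm x \<le> M * norm (w - w')"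
      using mult_left_mono[OF M[OF x] norm_ge_zero, of "w - w'"] by (simp add: mult.commute)
    finally show "w \<bullet> x \<le> (SUP x\<in>D. w' \<bullet> x) + M * norm (w - w')" by simp
  qed
  from this[of u v] this[of v u] show ?thesis by (simp add: norm_minus_commute abs_le_iff)
qed

text \<open>Shrink a ball of radius \<open>\<rho>\<close> inside \<open>L\<close> homothetically towards \<open>y\<close> until it is about to
  leave \<open>L\<close>; the maximiser of the ratio \<open>g\<close> is the normal at the point where it touches the
  boundary.\<close>
lemma touching_normal_separation:
  fixes L :: "'a::euclidean_space set"
  assumes L: "compact_convex L" and int: "interior L \<noteq> {}" and y: "y \<notin> L"
  obtains u where "u \<in> touching_normals L" "\<And>z. z \<in> L \<Longrightarrow> u \<bullet> z < u \<bullet> y"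
proof -
  have ne: "L \<noteq> {}" and "bounded L" using L by (auto simp: compact_convex_def compact_imp_bounded)
  obtain c \<rho>0 where c: "0 < \<rho>0" "cball c \<rho>0 \<subseteq> L"
    using int by (meson equals0I mem_interior_cball)
  \<comment> \<open>Half the radius keeps \<open>h u - \<rho>\<close> strictly positive for unit
    \<open>u\<close>, as the denominator of \<open>g\<close> requires.\<close>
  define \<rho> where "\<rho> = \<rho>0 / 2"
  have \<rho>: "0 < \<rho>" "\<rho> < \<rho>0" using c by (auto simp: \<rho>_def)
  define D where "D = (\<lambda>x. x - c) ` L"
  have D: "D \<noteq> {}" using ne by (simp add: D_def)
  obtain M where M: "\<And>x. x \<in> D \<Longrightarrow> norm x \<le> M"
    using bounded_translation_minus[OF \<open>bounded L\<close>, of c] unfolding D_def[symmetric] bounded_iff by blast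
  define h where "h u = (SUP x\<in>D. u \<bullet> x)" for u
  have lip: "\<bar>h u - h v\<bar> \<le> M * norm (u - v)" for u v
    unfolding h_def by (rule support_function_lipschitz[OF D M])
  have "0 \<le> M" using D M by (meson equals0I norm_ge_zero order_trans)
  have conth: "continuous_on S h" for S
    by (rule lipschitz_on_continuous_on[of M]) (use lip \<open>0 \<le> M\<close> in \<open>auto simp: lipschitz_on_def dist_norm\<close>)
  have bdd: "bdd_above ((\<lambda>x. w \<bullet> x) ` D)" for w
  proof (rule bdd_aboveI2)
    fix x assume "x \<in> D"
    then show "w \<bullet> x \<le> norm w * M"
      using norm_cauchy_schwarz[of w x] mult_left_mono[OF M norm_ge_zero, of x w] by linarith
  qed
  have hup: "u \<bullet> (z - c) \<le> h u" if "z \<in> L" for u z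
    unfolding h_def by (rule cSUP_upper[OF _ bdd]) (use that in \<open>simp add: D_def\<close>)
  have hleast: "h u \<le> b - u \<bullet> c" if "\<And>z. z \<in> L \<Longrightarrow> u \<bullet> z \<le> b" for u b
    unfolding h_def by (rule cSUP_least[OF D]) (use that in \<open>auto simp: D_def inner_simps\<close>)
  have hpos: "\<rho> < h u" if "norm u = 1" for u
  proof -
    have "c + \<rho>0 *\<^sub>R u \<in> L" using c that by (intro subsetD[OF c(2)]) (simp add: dist_norm)
    from hup[OF this, of u] have "\<rho>0 \<le> h u" using that by (simp add: norm_eq_1)
    then show ?thesis using \<rho> by simp
  qed
  \<comment> \<open>For \<open>s\<close> between 0 and 1, the ball of radius
    \<open>(1 - s) * \<rho>\<close> about \<open>c + s *\<^sub>R (y - c)\<close> lies in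
    \<open>L\<close> exactly if \<open>s * (w \<bullet> (y - c) - \<rho>) \<le> h w - \<rho>\<close>
    for all unit \<open>w\<close>, that is, \<open>s * g w \<le> 1\<close>. The largest such
    \<open>s\<close> is the reciprocal of the maximum of \<open>g\<close>.\<close>
  define g where "g u = (u \<bullet> (y - c) - \<rho>) / (h u - \<rho>)" for u
  obtain u0 b0 where u0: "norm u0 = 1" "\<And>z. z \<in> L \<Longrightarrow> u0 \<bullet> z \<le> b0" "b0 < u0 \<bullet> y"
    using unit_separation[OF L y] by metis
  \<comment> \<open>A ratio above 1 at a normal separating \<open>y\<close> makes
    \<open>s < 1\<close> below, so that the radius \<open>r\<close> is positive.\<close>
  have g0: "1 < g u0"
    using hleast[OF u0(2)] hpos[OF u0(1)] u0(3) by (simp add: g_def field_simps inner_simps)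
  have "continuous_on (sphere 0 1) g"
    unfolding g_def using hpos by (intro continuous_intros conth) force
  moreover have "sphere (0::'a) 1 \<noteq> {}" using u0 by auto
  ultimately obtain u where u: "norm u = 1" and umax: "\<And>w. norm w = 1 \<Longrightarrow> g w \<le> g u"
    using continuous_attains_sup[OF compact_sphere, of 0 1 g] by auto
  define s where "s = 1 / g u"
  have "1 < g u" using g0 umax[OF u0(1)] by simp
  then have s: "0 < s" "s < 1" and gs: "s * g u = 1" by (auto simp: s_def)
  have tight: "s * (u \<bullet> (y - c) - \<rho>) = h u - \<rho>"
    using \<open>1 < g u\<close> hpos[OF u] by (simp add: s_def g_def)
  have slack: "s * (w \<bullet> (y - c) - \<rho>) \<le> h w - \<rho>" if w: "norm w = 1" for w
  proof -
    have "w \<bullet> (y - c) - \<rho> \<le> g u * (h w - \<rho>)"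
      using umax[OF w] hpos[OF w] by (simp add: g_def pos_divide_le_eq)
    then have "s * (w \<bullet> (y - c) - \<rho>) \<le> s * (g u * (h w - \<rho>))"
      using s by (simp add: mult_left_mono)
    then show ?thesis using gs by (simp add: mult.assoc[symmetric])
  qed
  define r where "r = (1 - s) * \<rho>"
  define c' where "c' = c + s *\<^sub>R (y - c)"
  have r: "0 < r" using s \<rho> by (simp add: r_def)
  have "cball c' r \<subseteq> L"
  proof
    fix z assume z: "z \<in> cball c' r"
    show "z \<in> L"
    proof (rule ccontr)
      assume "z \<notin> L"
      then obtain w b where w: "norm w = 1" "\<And>x. x \<in> L \<Longrightarrow> w \<bullet> x \<le> b" "b < w \<bullet> z"
        using unit_separation[OF L] by metis
      have "w \<bullet> (z - c') \<le> r"
        using norm_cauchy_schwarz[of w "z - c'"] w(1) z by (simp add: dist_norm norm_minus_commute)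
      then have "w \<bullet> (z - c) \<le> s * (w \<bullet> (y - c)) + r"
        by (simp add: c'_def inner_simps algebra_simps)
      also have "\<dots> \<le> h w" using slack[OF w(1)] by (simp add: r_def algebra_simps)
      also have "\<dots> \<le> b - w \<bullet> c" using hleast[OF w(2)] by simp
      finally show False using w(3) by (simp add: inner_simps)
    qed
  qed
  \<comment> \<open>By \<open>tight\<close>, the maximiser \<open>u\<close> attains equality: the
    half-space bounded by the tangent plane of the ball in direction \<open>u\<close> contains
    \<open>L\<close>.\<close>
  moreover have "u \<bullet> z \<le> u \<bullet> c' + r" if "z \<in> L" for z
    using hup[OF that, of u] tight by (simp add: c'_def r_def inner_simps algebra_simps)
  ultimately have "u \<in> touching_normals L" using u r by (auto simp: touching_normals_def)
  moreover have "u \<bullet> z < u \<bullet> y" if "z \<in> L" for z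
  proof -
    have "u \<bullet> (y - c) - \<rho> = g u * (h u - \<rho>)" using hpos[OF u] by (simp add: g_def)
    moreover have "1 * (h u - \<rho>) < g u * (h u - \<rho>)"
      using \<open>1 < g u\<close> hpos[OF u] by (intro mult_strict_right_mono) auto
    ultimately have "h u < u \<bullet> (y - c)" by simp
    then show ?thesis using hup[OF that, of u] by (simp add: inner_simps)
  qed
  ultimately show thesis by (rule that)
qed

text \<open>Central symmetry makes the point reflection sending \<open>z\<close> to
  \<open>- z - v\<close> map \<open>L\<close> into itself; it carries a touching ball to one that
  touches with the opposite normal.\<close>

lemma touching_normals_uminus:
  assumes "centrally_symmetric L" and u: "u \<in> touching_normals L"
  shows "- u \<in> touching_normals L"
proof -
  obtain v where v: "uminus ` L = (+) v ` L" using assms(1) by (auto simp: centrally_symmetric_def)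
  have refl: "- z - v \<in> L" if "z \<in> L" for z
  proof -
    have "- z \<in> (+) v ` L" using that v by blast
    then obtain w where "w \<in> L" "- z = v + w" by auto
    then show ?thesis by (simp add: algebra_simps)
  qed
  obtain c r where cr: "norm u = 1" "0 < r" "cball c r \<subseteq> L" "\<forall>z\<in>L. u \<bullet> z \<le> u \<bullet> c + r"
    using u by (auto simp: touching_normals_def)
  have "cball (- c - v) r \<subseteq> L"
  proof
    fix z assume "z \<in> cball (- c - v) r"
    moreover have "c - (- z - v) = - ((- c - v) - z)" by simp
    then have "dist c (- z - v) = dist (- c - v) z" unfolding dist_norm by (metis norm_minus_cancel)
    ultimately have "- z - v \<in> cball c r" by simp
    then have "- (- z - v) - v \<in> L" using cr refl by blast
    then show "z \<in> L" by simp
  qed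
  moreover have "- u \<bullet> z \<le> - u \<bullet> (- c - v) + r" if "z \<in> L" for z
    using cr(4) refl[OF that] by (force simp: inner_simps)
  ultimately show ?thesis using cr by (auto simp: touching_normals_def)
qed

section \<open>Circuits among touching normals obstruct reliability\<close>

text \<open>Let \<open>x i\<close> be the boundary point with normal \<open>f i\<close>. Positivity of the relation among the \<open>f i\<close>
  means that the hull of the \<open>x i\<close> cannot be enlarged inside \<open>L\<close>, while the last hypothesis on
  the \<open>f i\<close> lets every shadow of it be moved into the interior of the shadow of \<open>L\<close>, with room
  for enlargement that is uniform by compactness of the unit sphere.\<close>
lemma not_reliable_positive_relation:
  fixes L :: "'a::euclidean_space set" and f :: "'b \<Rightarrow> 'a"
  assumes L: "compact_convex L" and I: "finite I" "I \<noteq> {}"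
    and f: "\<And>i. i \<in> I \<Longrightarrow> f i \<in> touching_normals L"
    and a: "\<And>i. i \<in> I \<Longrightarrow> 0 < a i" and rel: "(\<Sum>i\<in>I. a i *\<^sub>R f i) = 0"
    and push: "\<And>n. n \<noteq> 0 \<Longrightarrow> \<exists>v. \<forall>i\<in>I. f i \<bullet> n = 0 \<longrightarrow> v \<bullet> f i < 0"
    and d: "d < DIM('a)"
  shows "\<not> reliable d L"
proof
  assume reliable: "reliable d L"
  have nf: "norm (f i) = 1" if "i \<in> I" for i using f[OF that] by (simp add: touching_normals_def)
  have "\<forall>i\<in>I. \<exists>c r. 0 < r \<and> cball c r \<subseteq> L \<and> (\<forall>z\<in>L. f i \<bullet> z \<le> f i \<bullet> c + r)"
    using f by (simp add: touching_normals_def)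
  then obtain c r where r: "\<And>i. i \<in> I \<Longrightarrow> 0 < r i" and ball: "\<And>i. i \<in> I \<Longrightarrow> cball (c i) (r i) \<subseteq> L"
    and supp: "\<And>i z. i \<in> I \<Longrightarrow> z \<in> L \<Longrightarrow> f i \<bullet> z \<le> f i \<bullet> c i + r i"
    by metis
  define x where "x i = c i + r i *\<^sub>R f i" for i
  have fx: "f i \<bullet> x i = f i \<bullet> c i + r i" if "i \<in> I" for i
    using nf[OF that] by (simp add: x_def inner_simps norm_eq_1)
  have push_in: "\<exists>v t. \<forall>i\<in>I. x i + v + t i *\<^sub>R n \<in> interior L" if n: "n \<noteq> 0" for n
  proof -
    obtain v where v: "\<And>i. i \<in> I \<Longrightarrow> f i \<bullet> n = 0 \<Longrightarrow> v \<bullet> f i < 0" using push[OF n] by blast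
    \<comment> \<open>The factor makes the inner product of \<open>w i\<close> and
      \<open>f i\<close> equal to -1 whenever \<open>f i\<close> is not orthogonal to
      \<open>n\<close>; otherwise \<open>v\<close> alone makes it negative.\<close>
    define t where "t i = (if f i \<bullet> n = 0 then 0 else (- 1 - v \<bullet> f i) / (f i \<bullet> n))" for i
    define w where "w i = v + t i *\<^sub>R n" for i
    have w: "w i \<bullet> f i < 0" if "i \<in> I" for i
      using v[OF that] by (auto simp: w_def t_def inner_simps inner_commute)
    have "\<forall>\<^sub>F \<delta> in at_right 0. \<forall>i\<in>I. x i + \<delta> *\<^sub>R w i \<in> interior L"
    proof (rule eventually_ball_finite[OF I(1)], rule ballI)
      fix i assume i: "i \<in> I"
      \<comment> \<open>This is the change of the squared distance to \<open>c i\<close> under the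
        step, divided by \<open>\<delta>\<close>; a negative limit puts the moved point into the
        open ball.\<close>
      have "((\<lambda>\<delta>. 2 * r i * (f i \<bullet> w i) + \<delta> * (norm (w i))\<^sup>2) \<longlongrightarrow>
          2 * r i * (f i \<bullet> w i) + 0 * (norm (w i))\<^sup>2) (at_right (0::real))"
        by (intro tendsto_intros)
      moreover have "2 * r i * (f i \<bullet> w i) + 0 * (norm (w i))\<^sup>2 < 0"
        using r[OF i] w[OF i] by (simp add: inner_commute mult_pos_neg)
      ultimately have "\<forall>\<^sub>F \<delta> in at_right 0. 2 * r i * (f i \<bullet> w i) + \<delta> * (norm (w i))\<^sup>2 < 0"
        by (rule order_tendstoD(2))
      moreover have "\<forall>\<^sub>F \<delta> in at_right (0::real). 0 < \<delta>" by (rule eventually_at_right_less)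
      ultimately show "\<forall>\<^sub>F \<delta> in at_right 0. x i + \<delta> *\<^sub>R w i \<in> interior L"
      proof eventually_elim
        case (elim \<delta>)
        have "f i \<bullet> f i = 1" using nf[OF i] by (simp add: norm_eq_1)
        then have "(norm (r i *\<^sub>R f i + \<delta> *\<^sub>R w i))\<^sup>2
            = (r i)\<^sup>2 + \<delta> * (2 * r i * (f i \<bullet> w i) + \<delta> * (norm (w i))\<^sup>2)"
          unfolding power2_norm_eq_inner
          by (simp add: inner_add_left inner_add_right inner_commute[of "w i" "f i"] power2_eq_square algebra_simps)
        also have "\<dots> < (r i)\<^sup>2" using mult_pos_neg[OF elim(2) elim(1)] by simp
        finally have "norm (r i *\<^sub>R f i + \<delta> *\<^sub>R w i) < r i"
          using power2_less_imp_less r[OF i] less_imp_le by blast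
        then have "x i + \<delta> *\<^sub>R w i \<in> ball (c i) (r i)"
          using dist_commute[of "c i" "x i + \<delta> *\<^sub>R w i"] by (simp add: x_def dist_norm)
        moreover have "ball (c i) (r i) \<subseteq> interior L"
          using ball[OF i] ball_subset_cball by (intro interior_maximal) auto
        ultimately show ?case by blast
      qed
    qed
    then obtain \<delta> where "\<forall>i\<in>I. x i + \<delta> *\<^sub>R w i \<in> interior L"
      using eventually_happens'[OF trivial_limit_at_right_real] by blast
    then have "\<forall>i\<in>I. x i + \<delta> *\<^sub>R v + (\<delta> * t i) *\<^sub>R n \<in> interior L"
      by (simp add: w_def algebra_simps)
    then show ?thesis by (intro exI[of _ "\<delta> *\<^sub>R v"] exI[of _ "\<lambda>i. \<delta> * t i"])
  qed
  \<comment> \<open>If no \<open>\<epsilon>\<close> served all directions, the directions failing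
    for \<open>1 / (k + 1)\<close> would accumulate at some \<open>l\<close>; the interior positions
    available for \<open>l\<close> persist nearby because the interior is open.\<close>
  have "\<exists>\<epsilon>>0. \<forall>n. norm n = 1 \<longrightarrow> (\<exists>v t. \<forall>i\<in>I. (1 + \<epsilon>) *\<^sub>R x i + v + t i *\<^sub>R n \<in> L)"
  proof (rule ccontr)
    assume contra: "\<not> ?thesis"
    have "\<exists>n. norm n = 1 \<and> \<not> (\<exists>v t. \<forall>i\<in>I. (1 + inverse (real (Suc k))) *\<^sub>R x i + v + t i *\<^sub>R n \<in> L)" for k
      using contra by (metis inverse_positive_iff_positive of_nat_0_less_iff zero_less_Suc)
    then obtain N where N: "\<And>k. norm (N k) = 1"
      "\<And>k. \<not> (\<exists>v t. \<forall>i\<in>I. (1 + inverse (real (Suc k))) *\<^sub>R x i + v + t i *\<^sub>R N k \<in> L)"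
      by metis
    have "\<forall>k. N k \<in> sphere 0 1" using N by simp
    with compact_sphere obtain l \<sigma> where l: "l \<in> sphere (0::'a) 1" and \<sigma>: "strict_mono \<sigma>"
      and lim: "(N \<circ> \<sigma>) \<longlonglongrightarrow> l"
      unfolding compact_def by metis
    have "l \<noteq> 0" using l by auto
    then obtain v t where vt: "\<And>i. i \<in> I \<Longrightarrow> x i + v + t i *\<^sub>R l \<in> interior L"
      using push_in by metis
    have "\<forall>\<^sub>F k in sequentially. \<forall>i\<in>I.
        (1 + inverse (real (Suc (\<sigma> k)))) *\<^sub>R x i + v + t i *\<^sub>R (N \<circ> \<sigma>) k \<in> interior L"
    proof (rule eventually_ball_finite[OF I(1)], rule ballI)
      fix i assume i: "i \<in> I"
      have "((\<lambda>k. inverse (real (Suc k))) \<circ> \<sigma>) \<longlonglongrightarrow> 0"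
        by (rule LIMSEQ_subseq_LIMSEQ[OF LIMSEQ_inverse_real_of_nat \<sigma>])
      then have "(\<lambda>k. inverse (real (Suc (\<sigma> k)))) \<longlonglongrightarrow> 0" by (simp add: o_def)
      then have "(\<lambda>k. (1 + inverse (real (Suc (\<sigma> k)))) *\<^sub>R x i + v + t i *\<^sub>R (N \<circ> \<sigma>) k)
          \<longlonglongrightarrow> (1 + 0) *\<^sub>R x i + v + t i *\<^sub>R l"
        by (intro tendsto_intros lim)
      then show "\<forall>\<^sub>F k in sequentially.
          (1 + inverse (real (Suc (\<sigma> k)))) *\<^sub>R x i + v + t i *\<^sub>R (N \<circ> \<sigma>) k \<in> interior L"
        using vt[OF i] by (intro topological_tendstoD) auto
    qed
    then obtain k where "\<forall>i\<in>I.
        (1 + inverse (real (Suc (\<sigma> k)))) *\<^sub>R x i + v + t i *\<^sub>R N (\<sigma> k) \<in> interior L"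
      using eventually_happens'[OF sequentially_bot] by fastforce
    then show False using N(2)[of "\<sigma> k"] interior_subset by blast
  qed
  then obtain \<epsilon> where \<epsilon>: "0 < \<epsilon>"
    and room: "\<And>n. norm n = 1 \<Longrightarrow> \<exists>v t. \<forall>i\<in>I. (1 + \<epsilon>) *\<^sub>R x i + v + t i *\<^sub>R n \<in> L"
    by blast
  define X where "X = (\<lambda>i. (1 + \<epsilon>) *\<^sub>R x i) ` I"
  define K where "K = convex hull X"
  have "compact_convex K"
    using I by (auto simp: compact_convex_def K_def X_def finite_imp_compact_convex_hull)
  moreover have "contains_translate (orth_proj \<xi> ` L) (orth_proj \<xi> ` K)"
    if \<xi>: "subspace \<xi>" "dim \<xi> = d" for \<xi>
  proof -
    \<comment> \<open>As \<open>d < DIM('a)\<close>, some unit \<open>n\<close> is orthogonal to the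
      subspace; the individual shifts along \<open>n\<close> vanish in the shadow, which leaves only
      the common translation \<open>v\<close>.\<close>
    obtain n0 where n0: "n0 \<noteq> 0" "\<And>y. y \<in> span \<xi> \<Longrightarrow> orthogonal n0 y"
      using orthogonal_to_subspace_exists[of \<xi>] \<xi> d by blast
    define n where "n = n0 /\<^sub>R norm n0"
    have n: "norm n = 1" using n0 by (simp add: n_def)
    have lin: "linear (orth_proj \<xi>)" by (rule linear_orth_proj[OF \<xi>(1)])
    have Pn: "orth_proj \<xi> n = 0"
      using \<xi>(1) n0(2) by (intro orth_proj_unique) (auto simp: n_def subspace_0 span_base orthogonal_clauses)
    obtain v t where vt: "\<And>i. i \<in> I \<Longrightarrow> (1 + \<epsilon>) *\<^sub>R x i + v + t i *\<^sub>R n \<in> L" using room[OF n] by blast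
    have "convex (orth_proj \<xi> -` (orth_proj \<xi> ` L))"
      using L lin by (intro convex_linear_vimage convex_linear_image) (auto simp: compact_convex_def)
    then have conv: "convex ((\<lambda>z. v + z) -` (orth_proj \<xi> -` (orth_proj \<xi> ` L)))"
    proof -
      have "(\<lambda>z. v + z) -` S = (+) (- v) ` S" for S :: "'a set"
        by (force intro: image_eqI[where x = "v + z" for z])
      then show ?thesis using \<open>convex (orth_proj \<xi> -` (orth_proj \<xi> ` L))\<close> by simp
    qed
    have "X \<subseteq> (\<lambda>z. v + z) -` (orth_proj \<xi> -` (orth_proj \<xi> ` L))"
    proof
      fix z assume "z \<in> X"
      then obtain i where i: "i \<in> I" "z = (1 + \<epsilon>) *\<^sub>R x i" by (auto simp: X_def)
      have "orth_proj \<xi> (v + z) = orth_proj \<xi> ((1 + \<epsilon>) *\<^sub>R x i + v + t i *\<^sub>R n)"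
        by (simp add: i linear_add[OF lin] linear_scale[OF lin] Pn)
      then show "z \<in> (\<lambda>z. v + z) -` (orth_proj \<xi> -` (orth_proj \<xi> ` L))" using vt[OF i(1)] by auto
    qed
    then have "K \<subseteq> (\<lambda>z. v + z) -` (orth_proj \<xi> -` (orth_proj \<xi> ` L))"
      unfolding K_def by (rule hull_minimal) (rule conv)
    then have "(+) (orth_proj \<xi> v) ` orth_proj \<xi> ` K \<subseteq> orth_proj \<xi> ` L"
      by (auto simp: linear_add[OF lin])
    then show ?thesis unfolding contains_translate_def by blast
  qed
  ultimately have "contains_translate L K" using reliable unfolding reliable_def by blast
  then obtain v where v: "(+) v ` K \<subseteq> L" unfolding contains_translate_def by blast
  have le: "\<epsilon> * (f i \<bullet> x i) + f i \<bullet> v \<le> 0" if i: "i \<in> I" for i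
  proof -
    have "(1 + \<epsilon>) *\<^sub>R x i \<in> K" unfolding K_def X_def by (intro hull_inc imageI i)
    then have "v + (1 + \<epsilon>) *\<^sub>R x i \<in> L" using v by blast
    from supp[OF i this] show ?thesis using fx[OF i] by (simp add: inner_simps algebra_simps)
  qed
  have rel0: "(\<Sum>i\<in>I. a i * (f i \<bullet> p)) = 0" for p
  proof -
    have "(\<Sum>i\<in>I. a i * (f i \<bullet> p)) = (\<Sum>i\<in>I. a i *\<^sub>R f i) \<bullet> p" by (simp add: inner_sum_left)
    then show ?thesis using rel by simp
  qed
  \<comment> \<open>The relation annihilates the values at a fixed vector such as \<open>v\<close>
    or the centre \<open>c j\<close>. Comparison with \<open>c j\<close> makes the weighted sum of
    the support values \<open>f i \<bullet> x i\<close> positive, whereas \<open>le\<close> forces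
    it to be nonpositive.\<close>
  obtain j where j: "j \<in> I" using I by blast
  have cj: "c j \<in> L" using ball[OF j] r[OF j] by (auto simp: subset_iff)
  have "0 = (\<Sum>i\<in>I. a i * (f i \<bullet> c j))" by (simp add: rel0)
  also have "\<dots> < (\<Sum>i\<in>I. a i * (f i \<bullet> x i))"
  proof (rule sum_strict_mono_ex1[OF I(1)])
    show "\<forall>i\<in>I. a i * (f i \<bullet> c j) \<le> a i * (f i \<bullet> x i)"
      using supp[OF _ cj] a by (simp add: fx mult_left_mono less_imp_le)
    show "\<exists>i\<in>I. a i * (f i \<bullet> c j) < a i * (f i \<bullet> x i)"
      using j a[OF j] r[OF j] by (auto simp: fx intro!: bexI[of _ j])
  qed
  finally have "0 < \<epsilon> * (\<Sum>i\<in>I. a i * (f i \<bullet> x i))" using \<epsilon> by simp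
  also have "\<dots> = (\<Sum>i\<in>I. a i * (\<epsilon> * (f i \<bullet> x i) + f i \<bullet> v))"
    using rel0[of v] by (simp add: distrib_left sum.distrib sum_distrib_left algebra_simps)
  also have "\<dots> \<le> 0" using le a by (intro sum_nonpos) (simp add: mult_nonneg_nonpos less_imp_le)
  finally show False by simp
qed

text \<open>A relation with all coefficients nonzero becomes positive after sign changes, which
  symmetry permits. Given \<open>n\<close>, some vector of the relation is not orthogonal to it; the
  remaining ones are independent, so their inner products with \<open>v\<close> can all be made
  negative.\<close>

lemma reliable_symmetric_no_circuit:
  fixes L :: "'a::euclidean_space set"
  assumes L: "compact_convex L" "centrally_symmetric L" "reliable d L" and d: "d < DIM('a)"
    and B: "B \<subseteq> touching_normals L" "independent B" "span B = UNIV"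
    and w: "w \<in> touching_normals L" "w = (\<Sum>b\<in>B. c b *\<^sub>R b)"
  shows "\<exists>b\<in>B. c b = 0"
proof (rule ccontr)
  assume "\<not> ?thesis"
  then have c: "\<And>b. b \<in> B \<Longrightarrow> c b \<noteq> 0" by blast
  have fin: "finite B" using B(2) by (rule independent_imp_finite)
  \<comment> \<open>\<open>None\<close> marks the extra vector \<open>- w\<close>, so the family is
    indexed without regard to coincidences among its vectors.\<close>
  define f where "f i = (case i of None \<Rightarrow> - w | Some b \<Rightarrow> sgn (c b) *\<^sub>R b)" for i
  define a where "a i = (case i of None \<Rightarrow> 1 | Some b \<Rightarrow> \<bar>c b\<bar>)" for i
  let ?I = "insert None (Some ` B)"
  have "\<not> reliable d L"
  proof (rule not_reliable_positive_relation[OF L(1), of ?I f a, OF _ _ _ _ _ _ d])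
    show "f i \<in> touching_normals L" if "i \<in> ?I" for i
      using that c w(1) B(1) touching_normals_uminus[OF L(2)]
      by (auto simp: f_def sgn_real_def)
    show "0 < a i" if "i \<in> ?I" for i using that c by (auto simp: a_def)
    have "(\<Sum>i\<in>?I. a i *\<^sub>R f i) = - w + (\<Sum>b\<in>B. (\<bar>c b\<bar> * sgn (c b)) *\<^sub>R b)"
      using fin by (simp add: sum.reindex a_def f_def)
    then show "(\<Sum>i\<in>?I. a i *\<^sub>R f i) = 0" by (simp add: w(2) abs_mult_sgn mult.commute)
    fix n :: 'a assume n: "n \<noteq> 0"
    have ext: "\<exists>v. \<forall>b\<in>B. v \<bullet> b = g b" for g :: "'a \<Rightarrow> real"
    proof -
      obtain h where h: "linear h" "\<forall>b\<in>B. h b = g b"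
        using linear_independent_extend[OF B(2), of g] by blast
      have "adjoint h 1 \<bullet> b = h b" for b using adjoint_works[OF h(1), of b "1::real"] by (simp add: inner_commute)
      then show ?thesis using h(2) by (intro exI[of _ "adjoint h 1"]) simp
    qed
    show "\<exists>v. \<forall>i\<in>?I. f i \<bullet> n = 0 \<longrightarrow> v \<bullet> f i < 0"
    proof (cases "w \<bullet> n = 0")
      case False
      obtain v where "\<forall>b\<in>B. v \<bullet> b = - sgn (c b)" using ext[of "\<lambda>b. - sgn (c b)"] by blast
      then show ?thesis using False c by (intro exI[of _ v]) (auto simp: f_def sgn_mult_self_eq)
    next
      case True
      obtain b0 where b0: "b0 \<in> B" "b0 \<bullet> n \<noteq> 0"
      proof (rule ccontr)
        assume "\<not> thesis"
        then have "\<forall>b\<in>B. b \<bullet> n = 0" using that by blast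
        then have "orthogonal n n"
          using orthogonal_to_span[of n B n] B(3) by (simp add: orthogonal_def inner_commute)
        then show False using n by (simp add: orthogonal_def)
      qed
      \<comment> \<open>Here \<open>- w\<close> is constrained and \<open>b0\<close> is exempt, so
        the value at \<open>b0\<close> is free to outweigh all the others and yield
        \<open>v \<bullet> w = 1\<close>.\<close>
      define g where "g b = (if b = b0 then (1 + (\<Sum>b\<in>B - {b0}. \<bar>c b\<bar>)) / c b0 else - sgn (c b))" for b
      obtain v where v: "\<And>b. b \<in> B \<Longrightarrow> v \<bullet> b = g b" using ext[of g] by blast
      have "v \<bullet> w = (\<Sum>b\<in>B. c b * g b)" by (simp add: w(2) inner_sum_right v)
      also have "\<dots> = c b0 * g b0 + (\<Sum>b\<in>B - {b0}. c b * g b)" using fin b0(1) by (rule sum.remove)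
      also have "(\<Sum>b\<in>B - {b0}. c b * g b) = - (\<Sum>b\<in>B - {b0}. \<bar>c b\<bar>)"
        unfolding sum_negf[symmetric] by (rule sum.cong) (auto simp: g_def abs_sgn)
      also have "c b0 * g b0 = 1 + (\<Sum>b\<in>B - {b0}. \<bar>c b\<bar>)" using c[OF b0(1)] by (simp add: g_def)
      finally have "v \<bullet> w = 1" by simp
      moreover have "v \<bullet> (sgn (c b) *\<^sub>R b) < 0" if "b \<in> B" "b \<noteq> b0" for b
        using that c by (simp add: v g_def sgn_mult_self_eq)
      ultimately show ?thesis using b0(2) c
        by (intro exI[of _ v]) (auto simp: f_def sgn_zero_iff)
    qed
  qed (use fin in auto)
  then show False using L(3) by simp
qed

text \<open>No touching normal could separate a point shifted along a vector \<open>n\<close>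
  orthogonal to all of them, so \<open>L\<close> would contain a whole line, against
  boundedness.\<close>

lemma span_touching_normals:
  fixes L :: "'a::euclidean_space set"
  assumes L: "compact_convex L" and int: "interior L \<noteq> {}"
  shows "span (touching_normals L) = UNIV"
proof (rule ccontr)
  assume "span (touching_normals L) \<noteq> UNIV"
  then have "dim (touching_normals L) < DIM('a)"
    using dim_eq_full dim_subset_UNIV le_neq_implies_less by blast
  then obtain n where n: "n \<noteq> 0" "\<And>y. y \<in> span (touching_normals L) \<Longrightarrow> orthogonal n y"
    using orthogonal_to_subspace_exists by blast
  obtain p where p: "p \<in> L" using L by (auto simp: compact_convex_def)
  have line: "p + t *\<^sub>R n \<in> L" for t
  proof (rule ccontr)
    assume "p + t *\<^sub>R n \<notin> L"
    then obtain u where u: "u \<in> touching_normals L" "\<And>z. z \<in> L \<Longrightarrow> u \<bullet> z < u \<bullet> (p + t *\<^sub>R n)"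
      using touching_normal_separation[OF L int] by metis
    have "u \<bullet> n = 0" using n(2)[of u] u(1) by (simp add: span_base orthogonal_def inner_commute)
    then show False using u(2)[OF p] by (simp add: inner_simps)
  qed
  obtain M where M: "\<And>x. x \<in> L \<Longrightarrow> norm x \<le> M"
    using L compact_imp_bounded[of L] unfolding compact_convex_def bounded_iff by blast
  define t where "t = (M + norm p + 1) / norm n"
  have "0 \<le> M" using M[OF p] norm_ge_zero order_trans by blast
  then have "norm (t *\<^sub>R n) = M + norm p + 1" using n(1) by (simp add: t_def)
  moreover have "norm (t *\<^sub>R n) \<le> norm (p + t *\<^sub>R n) + norm p"
    using norm_triangle_ineq4[of "p + t *\<^sub>R n" p] by simp
  ultimately show False using M[OF line[of t]] by linarith
qed

section \<open>Spanning sets in three-space without four vectors in general position\<close>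

text \<open>In projective terms: a spanning set of points of the plane with no four in general position
  lies on a line, up to one point.\<close>
lemma no_circuit_split:
  fixes S :: "(real ^ 3) set"
  assumes span: "span S = UNIV"
    and no_circuit: "\<And>B w c. B \<subseteq> S \<Longrightarrow> independent B \<Longrightarrow> span B = UNIV \<Longrightarrow> w \<in> S \<Longrightarrow>
      w = (\<Sum>b\<in>B. c b *\<^sub>R b) \<Longrightarrow> \<exists>b\<in>B. c b = 0"
  obtains e f where "f \<bullet> e \<noteq> 0" "\<And>u. u \<in> S \<Longrightarrow> u \<bullet> e = 0 \<or> (\<exists>k. u = k *\<^sub>R f)"
proof -
  note conclude = that
  \<comment> \<open>Independence of an ordered triple, expressed by scalars: roles can be permuted,
    and coincident vectors are excluded automatically.\<close>
  define ind where "ind a b c \<longleftrightarrow>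
    (\<forall>x y z. x *\<^sub>R a + y *\<^sub>R b + z *\<^sub>R c = 0 \<longrightarrow> x = 0 \<and> y = 0 \<and> z = 0)" for a b c :: "real ^ 3"
  have indD: "x = 0 \<and> y = 0 \<and> z = 0" if "ind a b c" "x *\<^sub>R a + y *\<^sub>R b + z *\<^sub>R c = 0" for a b c x y z
    using that unfolding ind_def by blast
  have ind_swap: "ind b a c" "ind a c b" if "ind a b c" for a b c
  proof -
    have "y = 0 \<and> x = 0 \<and> z = 0" if "x *\<^sub>R b + y *\<^sub>R a + z *\<^sub>R c = 0" for x y z
      by (rule indD[OF \<open>ind a b c\<close>]) (use that in \<open>simp add: add_ac\<close>)
    then show "ind b a c" unfolding ind_def by blast
    have "x = 0 \<and> z = 0 \<and> y = 0" if "x *\<^sub>R a + y *\<^sub>R c + z *\<^sub>R b = 0" for x y z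
      by (rule indD[OF \<open>ind a b c\<close>]) (use that in \<open>simp add: add_ac\<close>)
    then show "ind a c b" unfolding ind_def by blast
  qed
  have distinct: "a \<noteq> b" "a \<noteq> c" "b \<noteq> c" if "ind a b c" for a b c
    using indD[OF that, of 1 "-1" 0] indD[OF that, of 1 0 "-1"] indD[OF that, of 0 1 "-1"] by auto
  have basis: "independent {a, b, c} \<and> span {a, b, c} = UNIV" if abc: "ind a b c" for a b c
  proof -
    have i: "independent {a, b, c}"
    proof (rule independent_if_scalars_zero)
      fix h x assume "(\<Sum>x\<in>{a, b, c}. h x *\<^sub>R x) = 0" "x \<in> {a, b, c}"
      then show "h x = 0"
        using distinct[OF abc] indD[OF abc, of "h a" "h b" "h c"] by (auto simp: add.assoc)
    qed simp
    then have "dim {a, b, c} = DIM(real ^ 3)"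
      using distinct[OF abc] by (simp add: dim_eq_card_independent)
    then show ?thesis using i dim_eq_full by blast
  qed
  \<comment> \<open>The hypothesis in coordinates: relative to a basis from \<open>S\<close>, no
    member of \<open>S\<close> has three nonzero coordinates.\<close>
  have three: "x = 0 \<or> y = 0 \<or> z = 0"
    if abc: "a \<in> S" "b \<in> S" "c \<in> S" "ind a b c" and w: "x *\<^sub>R a + y *\<^sub>R b + z *\<^sub>R c \<in> S" for a b c x y z
  proof -
    define h where "h v = (if v = a then x else if v = b then y else z)" for v
    have "\<exists>v\<in>{a, b, c}. h v = 0"
      by (rule no_circuit[OF _ _ _ w])
        (use abc basis[OF abc(4)] distinct[OF abc(4)] in \<open>auto simp: h_def add.assoc\<close>)
    then show ?thesis using distinct[OF abc(4)] by (auto simp: h_def)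
  qed
  \<comment> \<open>Exchange \<open>a\<close> for the first member, called \<open>v\<close>. Since
    \<open>three\<close> in the old basis forces \<open>y' = 0\<close>, the second member would have
    only nonzero coordinates \<open>x' / x\<close>, \<open>- x' * y / x\<close>, \<open>z'\<close>
    in the new one.\<close>
  have edge: "z' = 0 \<or> x' = 0"
    if abc: "a \<in> S" "b \<in> S" "c \<in> S" "ind a b c"
      and w: "x *\<^sub>R a + y *\<^sub>R b \<in> S" "x \<noteq> 0" "y \<noteq> 0"
      and w': "x' *\<^sub>R a + y' *\<^sub>R b + z' *\<^sub>R c \<in> S" for a b c x y x' y' z'
  proof (rule ccontr)
    assume "\<not> ?thesis"
    then have nz: "x' \<noteq> 0" "z' \<noteq> 0" by auto
    then have y': "y' = 0" using three[OF abc w'] by auto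
    define v where "v = x *\<^sub>R a + y *\<^sub>R b"
    have "ind v b c"
      unfolding ind_def
    proof (intro allI impI)
      fix \<alpha> \<beta> \<gamma> assume "\<alpha> *\<^sub>R v + \<beta> *\<^sub>R b + \<gamma> *\<^sub>R c = 0"
      then have "(\<alpha> * x) *\<^sub>R a + (\<alpha> * y + \<beta>) *\<^sub>R b + \<gamma> *\<^sub>R c = 0" by (simp add: v_def algebra_simps)
      from indD[OF abc(4) this] show "\<alpha> = 0 \<and> \<beta> = 0 \<and> \<gamma> = 0" using w by auto
    qed
    moreover have "(x' / x) *\<^sub>R v + (- x' * y / x) *\<^sub>R b + z' *\<^sub>R c = x' *\<^sub>R a + y' *\<^sub>R b + z' *\<^sub>R c"
      using w y' by (simp add: v_def algebra_simps)
    ultimately have "x' / x = 0 \<or> - x' * y / x = 0 \<or> z' = 0"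
      using three[of v b c "x' / x" "- x' * y / x" z'] abc w w' v_def by metis
    then show False using nz w by auto
  qed
  \<comment> \<open>When the members lie in the plane of \<open>a\<close> and \<open>b\<close> or on
    the line of \<open>c\<close>, a normal \<open>e\<close> of that plane and \<open>c\<close> in
    the role of \<open>f\<close> are the witnesses.\<close>
  have split: thesis
    if abc: "a \<in> S" "b \<in> S" "c \<in> S" "ind a b c"
      and cases: "\<And>x y z. x *\<^sub>R a + y *\<^sub>R b + z *\<^sub>R c \<in> S \<Longrightarrow> z = 0 \<or> x = 0 \<and> y = 0" for a b c
  proof -
    have "dim {a, b} \<le> card {a, b}" by (rule dim_le_card') simp
    also have "\<dots> < DIM(real ^ 3)" using distinct[OF abc(4)] by simp
    finally obtain e where e: "e \<noteq> 0" "\<And>y. y \<in> span {a, b} \<Longrightarrow> orthogonal e y"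
      using orthogonal_to_subspace_exists by blast
    have ab: "a \<bullet> e = 0" "b \<bullet> e = 0"
      using e(2) by (simp_all add: span_base orthogonal_def inner_commute)
    have repr: "\<exists>x y z. p = x *\<^sub>R a + y *\<^sub>R b + z *\<^sub>R c" for p
    proof -
      have "p \<in> span {a, b, c}" using basis[OF abc(4)] by simp
      then obtain x y z where "p - x *\<^sub>R a - y *\<^sub>R b = z *\<^sub>R c"
        by (auto simp: span_insert span_singleton)
      then show ?thesis by (metis add.assoc add_diff_cancel_left' diff_add_cancel add.commute)
    qed
    have ce: "c \<bullet> e \<noteq> 0"
    proof
      assume "c \<bullet> e = 0"
      moreover obtain x y z where "e = x *\<^sub>R a + y *\<^sub>R b + z *\<^sub>R c" using repr by blast
      ultimately have "e \<bullet> e = 0" using ab by (metis add_0 inner_add_left inner_scaleR_left mult_zero_right)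
      then show False using e(1) by simp
    qed
    have "u \<bullet> e = 0 \<or> (\<exists>k. u = k *\<^sub>R c)" if u: "u \<in> S" for u
    proof -
      obtain x y z where u': "u = x *\<^sub>R a + y *\<^sub>R b + z *\<^sub>R c" using repr by blast
      then show ?thesis using cases[of x y z] u ab by (auto simp: inner_simps)
    qed
    with ce show thesis by (rule conclude)
  qed
  \<comment> \<open>Applying \<open>edge\<close> also with \<open>a\<close> and \<open>b\<close>
    exchanged shows that one member with both coordinates nonzero confines all the others as
    \<open>split\<close> demands.\<close>
  have split_edge: thesis
    if abc: "a \<in> S" "b \<in> S" "c \<in> S" "ind a b c"
      and w: "x *\<^sub>R a + y *\<^sub>R b \<in> S" "x \<noteq> 0" "y \<noteq> 0" for a b c x y
  proof (rule split[OF abc])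
    fix x' y' z' assume w': "x' *\<^sub>R a + y' *\<^sub>R b + z' *\<^sub>R c \<in> S"
    have "z' = 0 \<or> x' = 0" by (rule edge[OF abc w w'])
    moreover have "z' = 0 \<or> y' = 0"
      by (rule edge[OF abc(2) abc(1) abc(3) ind_swap(1)[OF abc(4)] _ w(3) w(2), where y' = x'])
        (use w w' in \<open>simp_all add: add.commute\<close>)
    ultimately show "z' = 0 \<or> x' = 0 \<and> y' = 0" by blast
  qed
  obtain B where B: "B \<subseteq> S" "independent B" "card B = dim S" by (rule basis_exists)
  have "dim S = 3" using span dim_eq_full[of S] by simp
  then obtain a b c where abc: "B = {a, b, c}" "a \<noteq> b" "b \<noteq> c" "a \<noteq> c" using B(3) by (metis card_3_iff)
  have S: "a \<in> S" "b \<in> S" "c \<in> S" using B(1) abc by auto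
  have ind: "ind a b c"
    unfolding ind_def
  proof (intro allI impI)
    fix x y z assume xyz: "x *\<^sub>R a + y *\<^sub>R b + z *\<^sub>R c = 0"
    define h where "h v = (if v = a then x else if v = b then y else z)" for v
    have "(\<Sum>v\<in>B. h v *\<^sub>R v) = 0" using xyz abc by (simp add: h_def add.assoc)
    then have "h v = 0" if "v \<in> B" for v
      using independentD[OF B(2) _ subset_refl, of h v] that abc(1) by auto
    then have "h a = 0" "h b = 0" "h c = 0" using abc(1) by auto
    then show "x = 0 \<and> y = 0 \<and> z = 0" using abc by (simp add: h_def)
  qed
  show thesis
  proof (rule ccontr)
    \<comment> \<open>If no pair of basis vectors admits \<open>split_edge\<close>, every member is
      a multiple of \<open>a\<close>, \<open>b\<close> or \<open>c\<close>, and \<open>split\<close>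
      applies all the same.\<close>
    assume no: "\<not> thesis"
    have ab: "x = 0 \<or> y = 0" if "x *\<^sub>R a + y *\<^sub>R b \<in> S" for x y
      using split_edge[OF S ind that] no by blast
    have ac: "x = 0 \<or> y = 0" if "x *\<^sub>R a + y *\<^sub>R c \<in> S" for x y
      using split_edge[OF S(1) S(3) S(2) ind_swap(2)[OF ind] that] no by blast
    have bc: "x = 0 \<or> y = 0" if "x *\<^sub>R b + y *\<^sub>R c \<in> S" for x y
      using split_edge[OF S(2) S(3) S(1) ind_swap(2)[OF ind_swap(1)[OF ind]] that] no by blast
    have thesis
    proof (rule split[OF S ind])
      fix x y z assume w: "x *\<^sub>R a + y *\<^sub>R b + z *\<^sub>R c \<in> S"
      show "z = 0 \<or> x = 0 \<and> y = 0"
        using three[OF S ind w] ab[of x y] ac[of x z] bc[of y z] w by auto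
    qed
    then show False using no by blast
  qed
qed

section \<open>Assembling the equivalence in three-space\<close>

text \<open>\<open>L\<close> lies in a plane; with the normal of the plane as both \<open>e\<close>
  and \<open>f\<close>, the shift in the criterion vanishes.\<close>

lemma cylinder_if_empty_interior:
  fixes L :: "(real ^ 3) set"
  assumes L: "compact_convex L" and "interior L = {}"
  shows "cylinder L"
proof -
  obtain a b where ab: "a \<noteq> 0" "L \<subseteq> {x. a \<bullet> x = b}"
    using empty_interior_subset_hyperplane assms by (metis compact_convex_def)
  show ?thesis
  proof (rule cylinderI[OF L, of a a])
    fix x y assume "x \<in> L" "y \<in> L"
    then have "a \<bullet> x = b" "a \<bullet> y = b" using ab(2) by auto
    then show "x + ((a \<bullet> y - a \<bullet> x) / (a \<bullet> a)) *\<^sub>R a \<in> L" using \<open>x \<in> L\<close> by simp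
  qed (use ab in simp)
qed

theorem corollary5p2:
  fixes L :: "(real ^ 3) set"
  assumes "compact_convex L" and "centrally_symmetric L"
  shows "reliable 2 L \<longleftrightarrow> cylinder L"
proof
  assume "cylinder L"
  then show "reliable 2 L"
    unfolding cylinder_def by (intro decomposable_imp_reliable assms) simp_all
next
  assume rel: "reliable 2 L"
  show "cylinder L"
  proof (cases "interior L = {}")
    case True
    then show ?thesis using assms(1) by (rule cylinder_if_empty_interior[rotated])
  next
    case False
    obtain e f where fe: "f \<bullet> e \<noteq> 0"
      and R: "\<And>u. u \<in> touching_normals L \<Longrightarrow> u \<bullet> e = 0 \<or> (\<exists>k. u = k *\<^sub>R f)"
    proof (rule no_circuit_split)
      show "span (touching_normals L) = UNIV" by (rule span_touching_normals[OF assms(1) False])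
      show "\<exists>b\<in>B. c b = 0" if "B \<subseteq> touching_normals L" "independent B" "span B = UNIV"
        "w \<in> touching_normals L" "w = (\<Sum>b\<in>B. c b *\<^sub>R b)" for B w c
        by (rule reliable_symmetric_no_circuit[OF assms rel _ that]) simp
    qed blast
    \<comment> \<open>A touching normal \<open>u\<close> cannot separate the slid point
      \<open>?z\<close> from \<open>L\<close>: if orthogonal to \<open>e\<close>, it has the same
      value at \<open>?z\<close> as at \<open>x\<close>; if a multiple of \<open>f\<close>, the same
      as at \<open>y\<close>.\<close>
    show ?thesis
    proof (rule cylinderI[OF assms(1) fe], rule ccontr)
      fix x y assume xy: "x \<in> L" "y \<in> L"
      let ?z = "x + ((f \<bullet> y - f \<bullet> x) / (f \<bullet> e)) *\<^sub>R e"
      assume "?z \<notin> L"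
      then obtain u where u: "u \<in> touching_normals L" "\<And>z. z \<in> L \<Longrightarrow> u \<bullet> z < u \<bullet> ?z"
        using touching_normal_separation[OF assms(1) False] by metis
      from R[OF u(1)] show False
      proof
        assume "u \<bullet> e = 0"
        then show False using u(2)[OF xy(1)] by (simp add: inner_simps)
      next
        assume "\<exists>k. u = k *\<^sub>R f"
        then obtain k where "u = k *\<^sub>R f" by blast
        then have "u \<bullet> ?z = u \<bullet> y" using fe by (simp add: inner_simps field_simps)
        then show False using u(2)[OF xy(2)] by simp
      qed
    qed
  qed
qed

end
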